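(* Suppose that $s=(a,b,c,\theta)$ is a central configuration in $E$. Then $s$ is a trapezoid if and only if $c=ab$. In every such trapezoid the exterior sides $\overline{q_1q_2}$ and $\overline{q_3q_4}$ are parallel.
   Context: Coordinates: a point $(a,b,c,\theta)$ with $a,b,c>0$ and $\theta\in(0,\pi)$ encodes the convex quadrilateral with consecutive vertices $q_1=(1,0)$, $q_2=(a\cos\theta,a\sin\theta)$, $q_3=(-b,0)$, $q_4=(-c\cos\theta,-c\sin\theta)$. With $r_{ij}=\|q_i-q_j\|$: $r_{12}^2=a^2-2a\cos\theta+1$, $r_{23}^2=a^2+2ab\cos\theta+b^2$, $r_{13}=b+1$, $r_{14}^2=c^2+2c\cos\theta+1$, $r_{34}^2=b^2-2bc\cos\theta+c^2$, $r_{24}=a+c$. Let $\mathcal C$ be the set of $(a,b,c,\theta)$ with $a,b,c>0$, $\theta\in(0,\pi)$ such that $r_{13}>r_{12}$, $r_{24}>r_{12}$, $r_{12}\ge r_{14}\ge r_{34}$ and $r_{12}\ge r_{23}\ge r_{34}$. Let $F(a,b,c,\theta)=(r_{24}^3-r_{14}^3)(r_{13}^3-r_{12}^3)(r_{23}^3-r_{34}^3)-(r_{12}^3-r_{14}^3)(r_{24}^3-r_{34}^3)(r_{13}^3-r_{23}^3)$, and $E=\{s\in\mathcal C: F(s)=0\}$. Points of $E$ correspond to the four-body convex central configurations with positive masses, up to isometry, rescaling and relabeling. A trapezoid is a quadrilateral with at least one pair of opposite exterior sides parallel (so rhombi are included); $\overline{q_iq_j}$ denotes the side between vertices $q_i$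 and $q_j$. *)

theory Defs
  imports "HOL-Analysis.Analysis"
begin

type_synonym config = "real \<times> real \<times> real \<times> real"

text \<open>The diagonals of the quadrilateral meet at the origin under the angle \<open>\<theta>\<close>; \<open>1, a, b, c\<close> are the
  distances of the consecutive vertices to the origin. Only the indices 1 to 4 are meaningful
  (every other index yields the fourth vertex).\<close>

fun vertex :: "config \<Rightarrow> nat \<Rightarrow> real ^ 2" where
  "vertex (a, b, c, \<theta>) i =
     (if i = 1 then vector [1, 0]
      else if i = 2 then vector [a * cos \<theta>, a * sin \<theta>]
      else if i = 3 then vector [- b, 0]
      else vector [- c * cos \<theta>, - c * sin \<theta>])"

definition mdist :: "config \<Rightarrow> nat \<Rightarrow> nat \<Rightarrow> real" where
  "mdist s i j = norm (vertex s i - vertex s j)"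

definition config_region :: "config set" where
  "config_region = {s. \<exists>a b c \<theta>. s = (a, b, c, \<theta>) \<and> a > 0 \<and> b > 0 \<and> c > 0 \<and> 0 < \<theta> \<and> \<theta> < pi \<and>
     mdist s 1 3 > mdist s 1 2 \<and> mdist s 2 4 > mdist s 1 2 \<and>
     mdist s 1 2 \<ge> mdist s 1 4 \<and> mdist s 1 4 \<ge> mdist s 3 4 \<and>
     mdist s 1 2 \<ge> mdist s 2 3 \<and> mdist s 2 3 \<ge> mdist s 3 4}"

definition cc_fun :: "config \<Rightarrow> real" where
  "cc_fun s =
     (mdist s 2 4 ^ 3 - mdist s 1 4 ^ 3) * (mdist s 1 3 ^ 3 - mdist s 1 2 ^ 3)
       * (mdist s 2 3 ^ 3 - mdist s 3 4 ^ 3)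
     - (mdist s 1 2 ^ 3 - mdist s 1 4 ^ 3) * (mdist s 2 4 ^ 3 - mdist s 3 4 ^ 3)
       * (mdist s 1 3 ^ 3 - mdist s 2 3 ^ 3)"

text \<open>The four-body convex central configurations with positive masses, up to isometry, rescaling
  and relabeling.\<close>

definition convex_cc :: "config set" where
  "convex_cc = {s \<in> config_region. cc_fun s = 0}"

text \<open>Two sides are parallel when the lines through their endpoints are translates of each other.\<close>

definition parallel_sides :: "real ^ 2 \<Rightarrow> real ^ 2 \<Rightarrow> real ^ 2 \<Rightarrow> real ^ 2 \<Rightarrow> bool" where
  "parallel_sides p q p' q' \<longleftrightarrow> affine_parallel (affine hull {p, q}) (affine hull {p', q'})"

text \<open>Inclusive convention: parallelograms, in particular rhombi, are trapezoids. The exterior sides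
  join cyclically consecutive vertices.\<close>

definition is_trapezoid :: "config \<Rightarrow> bool" where
  "is_trapezoid s \<longleftrightarrow>
     parallel_sides (vertex s 1) (vertex s 2) (vertex s 3) (vertex s 4) \<or>
     parallel_sides (vertex s 2) (vertex s 3) (vertex s 4) (vertex s 1)"

lemma norm_vec2: "norm (x :: real ^ 2) = sqrt ((x $ 1)\<^sup>2 + (x $ 2)\<^sup>2)"
  by (simp add: norm_vec_def L2_set_def sum_2)

lemma mdist_formulas:
  assumes "a > 0" "b > 0" "c > 0"
  shows "(mdist (a, b, c, \<theta>) 1 2)\<^sup>2 = a\<^sup>2 - 2 * a * cos \<theta> + 1"
    and "(mdist (a, b, c, \<theta>) 2 3)\<^sup>2 = a\<^sup>2 + 2 * a * b * cos \<theta> + b\<^sup>2"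
    and "mdist (a, b, c, \<theta>) 1 3 = b + 1"
    and "(mdist (a, b, c, \<theta>) 1 4)\<^sup>2 = c\<^sup>2 + 2 * c * cos \<theta> + 1"
    and "(mdist (a, b, c, \<theta>) 3 4)\<^sup>2 = b\<^sup>2 - 2 * b * c * cos \<theta> + c\<^sup>2"
    and "mdist (a, b, c, \<theta>) 2 4 = a + c"
proof -
  have s: "(sin \<theta>)\<^sup>2 = 1 - (cos \<theta>)\<^sup>2"
    by (simp add: sin_squared_eq)
  have n: "(norm x)\<^sup>2 = (x $ 1)\<^sup>2 + (x $ 2)\<^sup>2" for x :: "real ^ 2"
    by (simp add: norm_vec2)
  show "(mdist (a, b, c, \<theta>) 1 2)\<^sup>2 = a\<^sup>2 - 2 * a * cos \<theta> + 1"
    "(mdist (a, b, c, \<theta>) 2 3)\<^sup>2 = a\<^sup>2 + 2 * a * b * cos \<theta> + b\<^sup>2"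
    "(mdist (a, b, c, \<theta>) 1 4)\<^sup>2 = c\<^sup>2 + 2 * c * cos \<theta> + 1"
    "(mdist (a, b, c, \<theta>) 3 4)\<^sup>2 = b\<^sup>2 - 2 * b * c * cos \<theta> + c\<^sup>2"
    by (simp_all add: mdist_def n power_mult_distrib s power2_sum power2_diff algebra_simps)
  show "mdist (a, b, c, \<theta>) 1 3 = b + 1"
    using assms by (simp add: mdist_def norm_vec2)
  have "(mdist (a, b, c, \<theta>) 2 4)\<^sup>2 = (a + c)\<^sup>2 * ((cos \<theta>)\<^sup>2 + (sin \<theta>)\<^sup>2)"
    unfolding mdist_def n by (simp del: sin_cos_squared_add2) algebra
  then have "(mdist (a, b, c, \<theta>) 2 4)\<^sup>2 = (a + c)\<^sup>2"
    by simp
  then show "mdist (a, b, c, \<theta>) 2 4 = a + c"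
    using assms by (simp add: mdist_def power2_eq_iff_nonneg)
qed

end

theory Submission
  imports Defs
begin

text \<open>Parallel sides have vanishing planar cross product. For \<open>q1q2\<close> and
  \<open>q3q4\<close> this product is, up to sign, \<open>sin \<theta> * (c - a * b)\<close>, and
  \<open>sin \<theta>\<close> is nonzero, so these sides are parallel exactly when
  \<open>c = a * b\<close> (\<open>parallel_12_34_iff\<close>). For the other pair the same
  computation gives \<open>a = b * c\<close> (\<open>parallel_23_41_imp\<close>). The ordering of
  the side lengths then leaves only \<open>b = 1\<close> (\<open>config_region_imp_b_eq_1\<close>):
  the quadrilateral is a parallelogram with \<open>a = c\<close>, so \<open>c = a * b\<close> holds
  again. Hence \<open>q1q2\<close> and \<open>q3q4\<close> are parallel in every trapezoid.\<close>

lemma parallel_sides_imp_scaleR: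
  assumes "parallel_sides p q p' q'"
  obtains k where "q' - p' = k *\<^sub>R (q - p)"
proof -
  obtain v where v: "affine hull {p', q'} = (\<lambda>x. v + x) ` (affine hull {p, q})"
    using assms by (auto simp: parallel_sides_def affine_parallel_def)
  have "p' \<in> affine hull {p', q'}" "q' \<in> affine hull {p', q'}"
    by (auto intro: hull_inc)
  then obtain t u where "p' = v + (p + t *\<^sub>R (q - p))" "q' = v + (p + u *\<^sub>R (q - p))"
    unfolding v unfolding affine_hull_2_alt by blast
  then have "q' - p' = (u - t) *\<^sub>R (q - p)"
    by (simp add: scaleR_left_diff_distrib)
  then show thesis by (rule that)
qed

text \<open>Translation by \<open>p' - p\<close> carries one line into the other; as
  \<open>k\<close> is nonzero, the parameter \<open>t\<close> can be rescaled to
  \<open>t / k\<close>, so the image is the whole line.\<close>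

lemma scaleR_imp_parallel_sides:
  assumes "k \<noteq> 0" and k: "q' - p' = k *\<^sub>R (q - p)"
  shows "parallel_sides p q p' q'"
proof -
  have "affine hull {p', q'} = (\<lambda>x. (p' - p) + x) ` (affine hull {p, q})"
    (is "?L = ?R")
  proof
    show "?L \<subseteq> ?R"
      by (force simp: affine_hull_2_alt k image_image)
    show "?R \<subseteq> ?L"
    proof
      fix x assume "x \<in> ?R"
      then obtain t where "x = (p' - p) + (p + t *\<^sub>R (q - p))"
        unfolding affine_hull_2_alt by blast
      then have "x = p' + (t / k) *\<^sub>R (q' - p')"
        using \<open>k \<noteq> 0\<close> by (simp add: k)
      then show "x \<in> ?L"
        by (auto simp: affine_hull_2_alt)
    qed
  qed
  then show ?thesis
    by (auto simp: parallel_sides_def affine_parallel_def)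
qed

lemma parallel_sides_imp_cross_eq_0:
  assumes "parallel_sides p q p' q'"
  shows "(q - p) $ 1 * (q' - p') $ 2 = (q - p) $ 2 * (q' - p') $ 1"
proof -
  obtain k where "q' - p' = k *\<^sub>R (q - p)"
    using parallel_sides_imp_scaleR[OF assms] .
  then show ?thesis by simp
qed

lemma parallel_12_34_iff:
  assumes "a > 0" "b > 0" "c > 0" "sin \<theta> \<noteq> 0"
  shows "parallel_sides (vertex (a, b, c, \<theta>) 1) (vertex (a, b, c, \<theta>) 2)
           (vertex (a, b, c, \<theta>) 3) (vertex (a, b, c, \<theta>) 4) \<longleftrightarrow> c = a * b"
    (is "?P \<longleftrightarrow> _")
proof
  assume ?P
  from parallel_sides_imp_cross_eq_0[OF this]
  have "sin \<theta> * (c - a * b) = 0"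
    by (simp add: algebra_simps)
  with assms show "c = a * b" by simp
next
  assume "c = a * b"
  \<comment> \<open>When \<open>c = a * b\<close>, the homothety of ratio \<open>- b\<close> about
    the intersection of the diagonals maps vertex 1 to vertex 3 and vertex 2 to vertex 4.\<close>
  then have "vertex (a, b, c, \<theta>) 4 - vertex (a, b, c, \<theta>) 3
      = (- b) *\<^sub>R (vertex (a, b, c, \<theta>) 2 - vertex (a, b, c, \<theta>) 1)"
    by (simp add: vec_eq_iff forall_2 algebra_simps)
  with assms show ?P
    by (intro scaleR_imp_parallel_sides[of "- b"]) auto
qed

lemma parallel_23_41_imp:
  assumes "sin \<theta> \<noteq> 0"
    and "parallel_sides (vertex (a, b, c, \<theta>) 2) (vertex (a, b, c, \<theta>) 3)
           (vertex (a, b, c, \<theta>) 4) (vertex (a, b, c, \<theta>) 1)"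
  shows "a = b * c"
proof -
  from parallel_sides_imp_cross_eq_0[OF assms(2)]
  have "sin \<theta> * (b * c - a) = 0"
    by (simp add: algebra_simps)
  with assms(1) show ?thesis by simp
qed

text \<open>When \<open>a = b * c\<close>, each comparison of two adjacent sides factors through \<open>1 + b\<close>,
  and what remains forces \<open>cos \<theta>\<close> to be both negative and positive unless \<open>b = 1\<close>.\<close>

lemma config_region_imp_b_eq_1:
  assumes "(a, b, c, \<theta>) \<in> config_region" and a: "a = b * c"
  shows "b = 1"
proof -
  let ?r = "mdist (a, b, c, \<theta>)" and ?k = "cos \<theta>"
  have pos: "a > 0" "b > 0" "c > 0"
    and le: "?r 1 4 \<le> ?r 1 2" "?r 2 3 \<le> ?r 1 2" "?r 3 4 \<le> ?r 1 4" "?r 3 4 \<le> ?r 2 3"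
    using assms(1) by (auto simp: config_region_def)
  have sq: "(?r i j)\<^sup>2 \<le> (?r i' j')\<^sup>2" if "?r i j \<le> ?r i' j'" for i j i' j'
    using that by (intro power_mono) (simp_all add: mdist_def)
  note le2 = le[THEN sq, unfolded mdist_formulas[OF pos]]
  \<comment> \<open>Written with the common positive factors exposed, in the order of
    \<open>le\<close>, so that they cancel in \<open>ineq\<close>.\<close>
  have "(1 + b) * (c * (2 * ?k)) \<le> (1 + b) * (c * (c * (b - 1)))"
    "(1 + b) * (2 * b * c * ?k) \<le> (1 + b) * (1 - b)"
    "(1 + b) * (b - 1) \<le> (1 + b) * (2 * c * ?k)"
    "(1 + b) * (c * (c * (1 - b))) \<le> (1 + b) * (c * (2 * b * ?k))"
    using le2 by (simp_all add: a algebra_simps power2_eq_square)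
  then have ineq: "2 * ?k \<le> c * (b - 1)" "2 * b * c * ?k \<le> 1 - b"
    "b - 1 \<le> 2 * c * ?k" "c * (1 - b) \<le> 2 * b * ?k"
    using pos by simp_all
  show ?thesis
  \<comment> \<open>For \<open>b < 1\<close> the clash is between the first and fourth inequalities,
    from \<open>r12 \<ge> r14\<close> and \<open>r23 \<ge> r34\<close>; for \<open>b > 1\<close> it
    is between the second and third, from \<open>r12 \<ge> r23\<close> and
    \<open>r14 \<ge> r34\<close>.\<close>
  proof (rule linorder_cases[of b 1])
    assume "b < 1"
    then have "c * (b - 1) < 0" "c * (1 - b) > 0"
      using pos by (simp_all add: mult_pos_neg)
    then have "?k < 0" "2 * b * ?k > 0"
      using ineq by linarith+
    with pos show ?thesis by (simp add: zero_less_mult_iff)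
  next
    assume "b > 1"
    then have "2 * b * c * ?k < 0" "2 * c * ?k > 0"
      using ineq by linarith+
    with pos show ?thesis by (simp add: zero_less_mult_iff mult_less_0_iff)
  qed
qed

theorem theorem4p3:
  fixes a b c \<theta> :: real
  assumes "(a, b, c, \<theta>) \<in> convex_cc"
  shows "(is_trapezoid (a, b, c, \<theta>) \<longleftrightarrow> c = a * b) \<and>
    (is_trapezoid (a, b, c, \<theta>) \<longrightarrow>
      parallel_sides (vertex (a, b, c, \<theta>) 1) (vertex (a, b, c, \<theta>) 2)
                     (vertex (a, b, c, \<theta>) 3) (vertex (a, b, c, \<theta>) 4))"
proof -
  have region: "(a, b, c, \<theta>) \<in> config_region"
    using assms by (simp add: convex_cc_def)
  then have pos: "a > 0" "b > 0" "c > 0" and "0 < \<theta>" "\<theta> < pi"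
    by (auto simp: config_region_def)
  then have sin: "sin \<theta> \<noteq> 0"
    using sin_gt_zero by fastforce
  note iff = parallel_12_34_iff[OF pos sin]
  have "c = a * b" if "is_trapezoid (a, b, c, \<theta>)"
    using that unfolding is_trapezoid_def
  proof
    assume "parallel_sides (vertex (a, b, c, \<theta>) 2) (vertex (a, b, c, \<theta>) 3)
      (vertex (a, b, c, \<theta>) 4) (vertex (a, b, c, \<theta>) 1)"
    then have "a = b * c" by (rule parallel_23_41_imp[OF sin])
    \<comment> \<open>With \<open>b = 1\<close>, both \<open>a = b * c\<close> and
      \<open>c = a * b\<close> say \<open>a = c\<close>.\<close>
    with config_region_imp_b_eq_1[OF region] show ?thesis by simp
  qed (simp only: iff)
  then show ?thesis
    using iff is_trapezoid_def by blast
qed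

end
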